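(* Let $\nu\in\mathcal{V}$ be a valuation-algebraic valuation. Then there exists a totally ordered subset $\mathfrak{v}=\{\nu_i\}_{i\in I}\subset\mathcal{V}$ without maximum such that every $f\in\mathbb{K}[x]$ is $\mathfrak{v}$-stable, $\nu=\sup_{i\in I}\nu_i$, and each $\nu_i$ is residue-transcendental.
   Context: A valuation on a commutative ring $A$ with unity is a map $\nu:A\to\Gamma_\infty=\Gamma\cup\{\infty\}$, with $\Gamma$ a totally ordered abelian group, such that $\nu(ab)=\nu(a)+\nu(b)$, $\nu(a+b)\ge\min\{\nu(a),\nu(b)\}$, $\nu(1)=0$, $\nu(0)=\infty$. It is a Krull valuation if $\nu(a)=\infty$ only for $a=0$; a Krull valuation on $\mathbb{K}[x]$ extends uniquely to $\mathbb{K}(x)$, with the same notation, and has residue field $\mathbb{K}(x)\nu=\{a\mid\nu(a)\ge0\}/\{a\mid\nu(a)>0\}$. Let $\mathbb{K}$ be a field, $\nu_0$ a valuation on $\mathbb{K}$ (Krull) with value group $\Gamma_0=\nu_0\mathbb{K}$ and residue field $\mathbb{K}\nu_0$, and fix a totally ordered divisible abelian group $\Gamma\supseteq\Gamma_0$. Put $\mathcal{V}=\{\nu_0\}\cup\{\nu:\mathbb{K}[x]\to\Gamma_\infty\mid \nu\text{ is a valuation extending }\nu_0\}$, partially ordered by $\nu_0\le\nu$ for all $\nu\in\mathcal{V}$, and, for $\nu,\mu\in\mathcal{V}\setminus\{\nu_0\}$, $\nu\le\mu$ iff $\nu(f)\le\mu(f)$ for all $f\in\mathbb{K}[x]$. For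 a totally ordered $\mathfrak{v}=\{\nu_i\}_{i\in I}$ of valuations on $\mathbb{K}[x]$, $I$ carries the induced total order. A valuation $\nu$ on $\mathbb{K}[x]$ extending $\nu_0$ is: value-transcendental if it is not Krull or the quotient of its value group (the subgroup of $\Gamma$ generated by its finite values) by $\nu_0\mathbb{K}$ is not a torsion group; residue-transcendental if it is Krull and the field extension $\mathbb{K}(x)\nu\mid\mathbb{K}\nu_0$ is transcendental; valuation-transcendental if it is value-transcendental or residue-transcendental; valuation-algebraic if it is not valuation-transcendental. A polynomial $f\in\mathbb{K}[x]$ is $\mathfrak{v}$-stable if there is $i_f\in I$ with $\nu_i(f)=\nu_{i_f}(f)$ for every $i\in I$ with $i\ge i_f$. If every $f\in\mathbb{K}[x]$ is $\mathfrak{v}$-stable, $\sup_{i\in I}\nu_i$ denotes the valuation $f\mapsto\nu_{i_f}(f)$. *)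

theory Defs
  imports
    "HOL-Algebra.Algebraic_Closure_Type"
    "HOL-Algebra.Finite_Extensions"
    "HOL-Computational_Algebra.Polynomial_Factorial"
    "HOL-Library.Lattice_Constructions"
    "HOL-Library.Option_ord"
begin

section \<open>The ordered monoid obtained by adjoining infinity\<close>

text \<open>The library type \<^typ>\<open>'g top\<close> adjoins a greatest element to a linear order.\<close>

abbreviation (input) fin :: "'g \<Rightarrow> 'g top" where "fin \<equiv> top.Value"
abbreviation (input) infty :: "'g top" where "infty \<equiv> top.Top"

instantiation top :: (ordered_comm_monoid_add) ordered_comm_monoid_add
begin

definition zero_top :: "'a top" where "0 = top.Value 0"

fun plus_top :: "'a top \<Rightarrow> 'a top \<Rightarrow> 'a top" where
  "top.Value a + top.Value b = top.Value (a + b)"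
| "top.Top + y = top.Top"
| "top.Value a + top.Top = top.Top"

instance
proof
  fix a b c :: "'a top"
  show "a + b + c = a + (b + c)"
    by (cases a; cases b; cases c) (simp_all add: add.assoc)
  show "a + b = b + a"
    by (cases a; cases b) (simp_all add: add.commute)
  show "0 + a = a"
    by (cases a) (simp_all add: zero_top_def)
  show "a \<le> b \<Longrightarrow> c + a \<le> c + b"
    by (cases a; cases b; cases c) (simp_all add: add_left_mono)
qed

end

section \<open>Valuations\<close>

definition valuation ::
    "('a::comm_ring_1 \<Rightarrow> 'g::linordered_ab_group_add top) \<Rightarrow> bool" where
  "valuation \<nu> \<longleftrightarrow>
     (\<forall>a b. \<nu> (a * b) = \<nu> a + \<nu> b) \<and>
     (\<forall>a b. min (\<nu> a) (\<nu> b) \<le> \<nu> (a + b)) \<and>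
     \<nu> 1 = 0 \<and> \<nu> 0 = infty"

definition krull_valuation ::
    "('a::comm_ring_1 \<Rightarrow> 'g::linordered_ab_group_add top) \<Rightarrow> bool" where
  "krull_valuation \<nu> \<longleftrightarrow> valuation \<nu> \<and> (\<forall>a. \<nu> a = infty \<longrightarrow> a = 0)"

definition fract_extension ::
    "('k::field poly \<Rightarrow> 'g::linordered_ab_group_add top) \<Rightarrow> 'k poly fract \<Rightarrow> 'g top" where
  "fract_extension \<nu> = (THE \<mu>. krull_valuation \<mu> \<and> (\<forall>f. \<mu> (to_fract f) = \<nu> f))"

text \<open>\<open>None\<close> plays the role of \<open>\<nu>\<^sub>0\<close>, which is a valuation on the base field and not on the
  polynomial ring; \<open>Some \<nu>\<close> is a valuation on the polynomial ring.  The library order on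
  options of functions is then the intended one: \<open>None\<close> is least, and \<open>Some \<nu> \<le> Some \<mu>\<close> means
  \<open>\<nu> f \<le> \<mu> f\<close> for all \<open>f\<close>.\<close>

definition valuation_poset ::
    "('k::field \<Rightarrow> 'g::linordered_ab_group_add top) \<Rightarrow> ('k poly \<Rightarrow> 'g top) option set" where
  "valuation_poset \<nu>\<^sub>0 =
     insert None (Some ` {\<nu>. valuation \<nu> \<and> (\<forall>a. \<nu> [:a:] = \<nu>\<^sub>0 a)})"

section \<open>Value groups\<close>

definition additive_group :: "'g::ab_group_add monoid" where
  "additive_group = \<lparr>carrier = UNIV, monoid.mult = (+), one = 0\<rparr>"

definition divisible_group :: "('a, 'b) monoid_scheme \<Rightarrow> bool" where
  "divisible_group G \<longleftrightarrow>
     comm_group G \<and> (\<forall>x\<in>carrier G. \<forall>n::nat. n > 0 \<longrightarrow> (\<exists>y\<in>carrier G. y [^]\<^bsub>G\<^esub> n = x))"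

definition torsion_group :: "('a, 'b) monoid_scheme \<Rightarrow> bool" where
  "torsion_group G \<longleftrightarrow> (\<forall>x\<in>carrier G. \<exists>n::nat. n > 0 \<and> x [^]\<^bsub>G\<^esub> n = \<one>\<^bsub>G\<^esub>)"

definition value_group ::
    "('a::comm_ring_1 \<Rightarrow> 'g::linordered_ab_group_add top) \<Rightarrow> 'g set" where
  "value_group \<nu> = generate additive_group {\<gamma>. fin \<gamma> \<in> range \<nu>}"

section \<open>Residue fields\<close>

definition valuation_ring ::
    "('a::field \<Rightarrow> 'g::linordered_ab_group_add top) \<Rightarrow> 'a ring" where
  "valuation_ring \<nu> = ring_of_type_algebra\<lparr>carrier := {a. 0 \<le> \<nu> a}\<rparr>"

definition valuation_ideal ::
    "('a::field \<Rightarrow> 'g::linordered_ab_group_add top) \<Rightarrow> 'a set" where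
  "valuation_ideal \<nu> = {a. 0 < \<nu> a}"

definition residue_field ::
    "('a::field \<Rightarrow> 'g::linordered_ab_group_add top) \<Rightarrow> 'a set ring" where
  "residue_field \<nu> = valuation_ring \<nu> Quot valuation_ideal \<nu>"

text \<open>For \<open>\<mu>\<close> on the rational function field, the embedding of the residue field of the base
  field sends the class of \<open>a\<close> to the class of the constant \<open>a\<close>; a class is a coset, i.e. a set
  of representatives.\<close>

definition residue_embedding ::
    "('k::field poly fract \<Rightarrow> 'g::linordered_ab_group_add top) \<Rightarrow> 'k set \<Rightarrow> 'k poly fract set" where
  "residue_embedding \<mu> C =
     (\<Union>a\<in>C. valuation_ideal \<mu> +>\<^bsub>valuation_ring \<mu>\<^esub> to_fract [:a:])"

definition transcendental_extension :: "('a, 'b) ring_scheme \<Rightarrow> 'a set \<Rightarrow> bool" where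
  "transcendental_extension L K \<longleftrightarrow> (\<exists>x\<in>carrier L. (ring.transcendental L over K) x)"

section \<open>Classification of the extensions to the polynomial ring\<close>

definition value_transcendental ::
    "('k::field \<Rightarrow> 'g::linordered_ab_group_add top) \<Rightarrow> ('k poly \<Rightarrow> 'g top) \<Rightarrow> bool" where
  "value_transcendental \<nu>\<^sub>0 \<nu> \<longleftrightarrow>
     \<not> krull_valuation \<nu> \<or>
     \<not> torsion_group (additive_group\<lparr>carrier := value_group \<nu>\<rparr> Mod value_group \<nu>\<^sub>0)"

definition residue_transcendental ::
    "('k::field \<Rightarrow> 'g::linordered_ab_group_add top) \<Rightarrow> ('k poly \<Rightarrow> 'g top) \<Rightarrow> bool" where
  "residue_transcendental \<nu>\<^sub>0 \<nu> \<longleftrightarrow>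
     krull_valuation \<nu> \<and>
     transcendental_extension (residue_field (fract_extension \<nu>))
       (residue_embedding (fract_extension \<nu>) ` carrier (residue_field \<nu>\<^sub>0))"

definition valuation_transcendental ::
    "('k::field \<Rightarrow> 'g::linordered_ab_group_add top) \<Rightarrow> ('k poly \<Rightarrow> 'g top) \<Rightarrow> bool" where
  "valuation_transcendental \<nu>\<^sub>0 \<nu> \<longleftrightarrow>
     value_transcendental \<nu>\<^sub>0 \<nu> \<or> residue_transcendental \<nu>\<^sub>0 \<nu>"

definition valuation_algebraic ::
    "('k::field \<Rightarrow> 'g::linordered_ab_group_add top) \<Rightarrow> ('k poly \<Rightarrow> 'g top) \<Rightarrow> bool" where
  "valuation_algebraic \<nu>\<^sub>0 \<nu> \<longleftrightarrow> \<not> valuation_transcendental \<nu>\<^sub>0 \<nu>"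

section \<open>Stability and suprema of families\<close>

text \<open>A totally ordered family is a set of functions, indexed by itself.\<close>

definition stable_from ::
    "('a \<Rightarrow> 'v::order) set \<Rightarrow> ('a \<Rightarrow> 'v) \<Rightarrow> 'a \<Rightarrow> bool" where
  "stable_from \<v> i f \<longleftrightarrow> i \<in> \<v> \<and> (\<forall>j\<in>\<v>. i \<le> j \<longrightarrow> j f = i f)"

definition stable_in :: "('a \<Rightarrow> 'v::order) set \<Rightarrow> 'a \<Rightarrow> bool" where
  "stable_in \<v> f \<longleftrightarrow> (\<exists>i. stable_from \<v> i f)"

definition stable_sup :: "('a \<Rightarrow> 'v::order) set \<Rightarrow> 'a \<Rightarrow> 'v" where
  "stable_sup \<v> f = (THE \<gamma>. \<exists>i. stable_from \<v> i f \<and> \<gamma> = i f)"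

section \<open>Well-definedness of the notions above\<close>

lemma stable_sup_eq:
  assumes "Complete_Partial_Order.chain (\<le>) \<v>" and "stable_from \<v> i f"
  shows "stable_sup \<v> f = i f"
  unfolding stable_sup_def
proof (rule the_equality)
  show "\<exists>j. stable_from \<v> j f \<and> i f = j f"
    using assms(2) by blast
  fix \<gamma> assume "\<exists>j. stable_from \<v> j f \<and> \<gamma> = j f"
  then obtain j where j: "stable_from \<v> j f" "\<gamma> = j f" by blast
  then have "i \<le> j \<or> j \<le> i"
    using assms by (auto simp: stable_from_def dest: chainD)
  then show "\<gamma> = i f"
    using assms(2) j by (auto simp: stable_from_def)
qed

lemma krull_valuation_finite:
  assumes "krull_valuation \<nu>" and "a \<noteq> 0"
  obtains g where "\<nu> a = fin g"
  using assms by (cases "\<nu> a") (auto simp: krull_valuation_def)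

lemma fin_diff_eq:
  fixes u :: "'g::linordered_ab_group_add top"
  shows "u + fin g = w \<longleftrightarrow> u = w + fin (- g)"
  by (cases u; cases w) auto

lemma fract_extension_ex1:
  fixes \<nu> :: "'k::field poly \<Rightarrow> 'g::linordered_ab_group_add top"
  assumes K: "krull_valuation \<nu>"
  shows "\<exists>!\<mu>. krull_valuation \<mu> \<and> (\<forall>f. \<mu> (to_fract f) = \<nu> f)"
proof -
  have mult: "\<nu> (a * b) = \<nu> a + \<nu> b" and plus: "min (\<nu> a) (\<nu> b) \<le> \<nu> (a + b)"
    and one: "\<nu> 1 = 0" and zero: "\<nu> 0 = infty" for a b
    using K by (auto simp: krull_valuation_def valuation_def)
  define \<mu> where "\<mu> q = (THE v. \<exists>a b. b \<noteq> 0 \<and> q = Fraction_Field.Fract a b \<and> v + \<nu> b = \<nu> a)" for q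
  have \<mu>: "\<mu> (Fraction_Field.Fract a b) = \<nu> a + fin (- g)" if b: "b \<noteq> 0" and g: "\<nu> b = fin g" for a b g
    unfolding \<mu>_def
  proof (rule the_equality)
    show "\<exists>a' b'. b' \<noteq> 0 \<and> Fraction_Field.Fract a b = Fraction_Field.Fract a' b' \<and>
        \<nu> a + fin (- g) + \<nu> b' = \<nu> a'"
      using that by (intro exI[of _ a] exI[of _ b]) (simp add: fin_diff_eq)
    fix v assume "\<exists>a' b'. b' \<noteq> 0 \<and> Fraction_Field.Fract a b = Fraction_Field.Fract a' b' \<and> v + \<nu> b' = \<nu> a'"
    then obtain a' b' where b': "b' \<noteq> 0" and eq: "a * b' = a' * b" and v: "v + \<nu> b' = \<nu> a'"
      using b by (auto simp: eq_fract)
    obtain h where h: "\<nu> b' = fin h" using K b' by (rule krull_valuation_finite)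
    have "\<nu> a + \<nu> b' = \<nu> a' + \<nu> b" using eq mult by metis
    then show "v = \<nu> a + fin (- g)"
      using v g h by (cases v; cases "\<nu> a"; cases "\<nu> a'") (auto simp: algebra_simps)
  qed
  have val: "valuation \<mu>"
    unfolding valuation_def
  proof (intro conjI allI)
    fix p q :: "'k poly fract"
    obtain a b where p: "p = Fraction_Field.Fract a b" "b \<noteq> 0" by (cases p)
    obtain c d where q: "q = Fraction_Field.Fract c d" "d \<noteq> 0" by (cases q)
    obtain g where g: "\<nu> b = fin g" using K p(2) by (rule krull_valuation_finite)
    obtain h where h: "\<nu> d = fin h" using K q(2) by (rule krull_valuation_finite)
    have bd: "b * d \<noteq> 0" "\<nu> (b * d) = fin (g + h)" using p q g h mult by auto
    show "\<mu> (p * q) = \<mu> p + \<mu> q"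
      using \<mu>[OF bd] \<mu>[OF p(2) g] \<mu>[OF q(2) h] p q
      by (cases "\<nu> a"; cases "\<nu> c") (auto simp: mult algebra_simps)
    have "min (\<nu> a + fin h) (\<nu> c + fin g) \<le> \<nu> (a * d + c * b)"
      using plus[of "a * d" "c * b"] by (simp add: mult g h)
    then show "min (\<mu> p) (\<mu> q) \<le> \<mu> (p + q)"
      using \<mu>[OF bd] \<mu>[OF p(2) g] \<mu>[OF q(2) h] p q
      by (cases "\<nu> a"; cases "\<nu> c"; cases "\<nu> (a * d + c * b)")
        (auto simp: min_def algebra_simps split: if_splits)
  next
    show "\<mu> 1 = 0" "\<mu> 0 = infty"
      using \<mu>[of 1 0 1] \<mu>[of 1 0 0] by (auto simp: one zero zero_top_def One_fract_def Zero_fract_def)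
  qed
  have ext: "\<mu> (to_fract f) = \<nu> f" for f
    using \<mu>[of 1 0 f] one by (cases "\<nu> f") (auto simp: to_fract_def zero_top_def)
  have "krull_valuation \<mu>"
    unfolding krull_valuation_def
  proof (intro conjI allI impI val)
    fix p assume inf: "\<mu> p = infty"
    obtain a b where p: "p = Fraction_Field.Fract a b" "b \<noteq> 0" by (cases p)
    obtain g where g: "\<nu> b = fin g" using K p(2) by (rule krull_valuation_finite)
    have "\<nu> a = infty" using \<mu>[OF p(2) g] inf p by (cases "\<nu> a") auto
    then have "a = 0" using K by (simp add: krull_valuation_def)
    then show "p = 0" using p by (simp add: eq_fract Zero_fract_def)
  qed
  moreover have "\<mu>' = \<mu>" if *: "krull_valuation \<mu>'" "\<forall>f. \<mu>' (to_fract f) = \<nu> f" for \<mu>'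
  proof
    fix p :: "'k poly fract"
    obtain a b where p: "p = Fraction_Field.Fract a b" "b \<noteq> 0" by (cases p)
    obtain g where g: "\<nu> b = fin g" using K p(2) by (rule krull_valuation_finite)
    have "p * to_fract b = to_fract a" using p by (simp add: to_fract_def eq_fract)
    then have "\<mu>' p + \<nu> b = \<nu> a"
      using * by (metis krull_valuation_def valuation_def)
    then show "\<mu>' p = \<mu> p" using \<mu>[OF p(2) g] p g by (simp add: fin_diff_eq)
  qed
  ultimately show ?thesis using ext by metis
qed

lemma fract_extension:
  assumes "krull_valuation \<nu>"
  shows "krull_valuation (fract_extension \<nu>)" "fract_extension \<nu> (to_fract f) = \<nu> f"
  using theI'[OF fract_extension_ex1[OF assms]] by (auto simp: fract_extension_def)

lemma valuation_uminus:
  assumes "valuation \<nu>"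
  shows "\<nu> (- a) = \<nu> a"
proof -
  have "\<nu> (- 1) + \<nu> (- 1) = 0"
    using assms by (metis valuation_def minus_mult_minus mult_1)
  then have "\<nu> (- 1) = 0"
    by (cases "\<nu> (- 1)") (auto simp: zero_top_def)
  then show ?thesis
    using assms by (metis valuation_def mult_minus1 add_0)
qed

lemma krull_valuation_inverse:
  fixes a :: "'a::field"
  assumes "krull_valuation \<nu>" and "\<nu> a = 0"
  shows "a \<noteq> 0" "\<nu> (inverse a) = 0"
proof -
  show "a \<noteq> 0"
    using assms by (auto simp: krull_valuation_def valuation_def zero_top_def)
  then have "\<nu> a + \<nu> (inverse a) = 0"
    using assms by (metis krull_valuation_def valuation_def right_inverse)
  then show "\<nu> (inverse a) = 0"
    using assms by simp
qed

lemma valuation_ring_simps [simp]: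
  "carrier (valuation_ring \<nu>) = {a. 0 \<le> \<nu> a}"
  "\<one>\<^bsub>valuation_ring \<nu>\<^esub> = 1" "\<zero>\<^bsub>valuation_ring \<nu>\<^esub> = 0"
  "a \<otimes>\<^bsub>valuation_ring \<nu>\<^esub> b = a * b" "a \<oplus>\<^bsub>valuation_ring \<nu>\<^esub> b = a + b"
  by (simp_all add: valuation_ring_def ring_of_type_algebra_def)

lemma valuation_ring_cring:
  fixes \<nu> :: "'a::field \<Rightarrow> 'g::linordered_ab_group_add top"
  assumes "krull_valuation \<nu>"
  shows "cring (valuation_ring \<nu>)"
proof (rule cringI)
  have v: "valuation \<nu>" using assms by (simp add: krull_valuation_def)
  have plus: "0 \<le> \<nu> (a + b)" if "0 \<le> \<nu> a" "0 \<le> \<nu> b" for a b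
    using that v by (meson valuation_def min.boundedI order_trans)
  have mult: "0 \<le> \<nu> (a * b)" if "0 \<le> \<nu> a" "0 \<le> \<nu> b" for a b
    using that v by (simp add: valuation_def add_nonneg_nonneg)
  show "abelian_group (valuation_ring \<nu>)"
  proof (rule abelian_groupI)
    show "\<exists>y\<in>carrier (valuation_ring \<nu>). y \<oplus>\<^bsub>valuation_ring \<nu>\<^esub> x = \<zero>\<^bsub>valuation_ring \<nu>\<^esub>"
      if "x \<in> carrier (valuation_ring \<nu>)" for x
      using that valuation_uminus[OF v, of x] by (intro bexI[of _ "- x"]) auto
  qed (use v plus in \<open>auto simp: valuation_def algebra_simps\<close>)
  show "comm_monoid (valuation_ring \<nu>)"
    by (rule comm_monoidI) (use v mult in \<open>auto simp: valuation_def algebra_simps\<close>)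
qed (auto simp: algebra_simps)

lemma valuation_ideal_maximal:
  fixes \<nu> :: "'a::field \<Rightarrow> 'g::linordered_ab_group_add top"
  assumes K: "krull_valuation \<nu>"
  shows "maximalideal (valuation_ideal \<nu>) (valuation_ring \<nu>)"
proof -
  have v: "valuation \<nu>" using K by (simp add: krull_valuation_def)
  interpret R: cring "valuation_ring \<nu>" using K by (rule valuation_ring_cring)
  have inv: "\<ominus>\<^bsub>valuation_ring \<nu>\<^esub> a = - a" if "0 \<le> \<nu> a" for a
    using that valuation_uminus[OF v, of a] by (intro R.minus_equality) auto
  have plus: "0 < \<nu> (a + b)" if "0 < \<nu> a" "0 < \<nu> b" for a b
    using that v by (metis valuation_def min_less_iff_conj order_less_le_trans)
  have mult: "0 < \<nu> (a * b)" if "0 < \<nu> a" "0 \<le> \<nu> b" for a b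
    using that v by (cases "\<nu> a"; cases "\<nu> b") (auto simp: valuation_def zero_top_def add_pos_nonneg)
  have ideal: "ideal (valuation_ideal \<nu>) (valuation_ring \<nu>)"
  proof (rule idealI)
    show "subgroup (valuation_ideal \<nu>) (add_monoid (valuation_ring \<nu>))"
    proof (rule R.add.subgroupI)
      show "valuation_ideal \<nu> \<noteq> {}"
        using v by (auto simp: valuation_def valuation_ideal_def zero_top_def intro!: exI[of _ 0])
      show "\<ominus>\<^bsub>valuation_ring \<nu>\<^esub> a \<in> valuation_ideal \<nu>" if "a \<in> valuation_ideal \<nu>" for a
        using that valuation_uminus[OF v, of a] inv[of a] by (auto simp: valuation_ideal_def)
    qed (auto simp: valuation_ideal_def plus)
  qed (use mult R.ring_axioms in \<open>auto simp: valuation_ideal_def mult.commute\<close>)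
  show ?thesis
  proof (rule maximalidealI[OF ideal])
    show "carrier (valuation_ring \<nu>) \<noteq> valuation_ideal \<nu>"
      using v by (auto simp: valuation_def valuation_ideal_def set_eq_iff intro!: exI[of _ 1])
    fix J assume J: "ideal J (valuation_ring \<nu>)" "valuation_ideal \<nu> \<subseteq> J"
      "J \<subseteq> carrier (valuation_ring \<nu>)"
    show "J = valuation_ideal \<nu> \<or> J = carrier (valuation_ring \<nu>)"
    proof (cases "J = valuation_ideal \<nu>")
      case False
      then obtain a where a: "a \<in> J" "\<nu> a = 0"
        using J by (auto simp: valuation_ideal_def order_le_less)
      have "inverse a * a \<in> J"
        using ideal.I_l_closed[OF J(1) a(1), of "inverse a"] krull_valuation_inverse[OF K a(2)] by simp
      then have "1 \<in> J"
        using krull_valuation_inverse[OF K a(2)] by simp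
      then show ?thesis
        using ideal.one_imp_carrier[OF J(1)] by simp
    qed simp
  qed
qed

lemma residue_field_field:
  assumes "krull_valuation \<nu>"
  shows "Ring.field (residue_field \<nu>)"
  unfolding residue_field_def
  using valuation_ideal_maximal[OF assms] valuation_ring_cring[OF assms]
  by (rule maximalideal.quotient_is_field)

lemma residue_embedding_coset:
  assumes "krull_valuation \<nu>\<^sub>0" and "krull_valuation \<mu>"
    and ext: "\<And>a. \<mu> (to_fract [:a:]) = \<nu>\<^sub>0 a" and a: "0 \<le> \<nu>\<^sub>0 a"
  shows "residue_embedding \<mu> (valuation_ideal \<nu>\<^sub>0 +>\<^bsub>valuation_ring \<nu>\<^sub>0\<^esub> a) =
    valuation_ideal \<mu> +>\<^bsub>valuation_ring \<mu>\<^esub> to_fract [:a:]"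
proof -
  interpret I: maximalideal "valuation_ideal \<mu>" "valuation_ring \<mu>"
    using assms(2) by (rule valuation_ideal_maximal)
  have eq: "valuation_ideal \<mu> +>\<^bsub>valuation_ring \<mu>\<^esub> to_fract [:h + a:] =
      valuation_ideal \<mu> +>\<^bsub>valuation_ring \<mu>\<^esub> to_fract [:a:]" if "0 < \<nu>\<^sub>0 h" for h
  proof (rule I.a_repr_independence[symmetric])
    have "to_fract [:h:] \<in> valuation_ideal \<mu>"
      using that by (simp add: valuation_ideal_def ext)
    moreover have "to_fract [:h + a:] = to_fract [:h:] + to_fract [:a:]"
      by (simp flip: to_fract_add)
    ultimately show "to_fract [:h + a:] \<in> valuation_ideal \<mu> +>\<^bsub>valuation_ring \<mu>\<^esub> to_fract [:a:]"
      by (auto simp: a_r_coset_def')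
    show "subgroup (valuation_ideal \<mu>) (add_monoid (valuation_ring \<mu>))"
      by (rule I.a_subgroup)
  qed (auto simp: ext a)
  have 0: "(0::'a) \<in> valuation_ideal \<nu>\<^sub>0"
    using assms(1) by (auto simp: valuation_ideal_def krull_valuation_def valuation_def zero_top_def)
  have "residue_embedding \<mu> (valuation_ideal \<nu>\<^sub>0 +>\<^bsub>valuation_ring \<nu>\<^sub>0\<^esub> a) =
      (\<Union>h\<in>valuation_ideal \<nu>\<^sub>0. valuation_ideal \<mu> +>\<^bsub>valuation_ring \<mu>\<^esub> to_fract [:h + a:])"
    by (simp add: residue_embedding_def a_r_coset_def'[of "valuation_ring \<nu>\<^sub>0"])
  also have "\<dots> = (\<Union>h\<in>valuation_ideal \<nu>\<^sub>0. valuation_ideal \<mu> +>\<^bsub>valuation_ring \<mu>\<^esub> to_fract [:a:])"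
    by (intro SUP_cong refl eq) (simp add: valuation_ideal_def)
  also have "\<dots> = valuation_ideal \<mu> +>\<^bsub>valuation_ring \<mu>\<^esub> to_fract [:a:]"
    using 0 by blast
  finally show ?thesis .
qed

lemma residue_embedding_hom:
  assumes K0: "krull_valuation \<nu>\<^sub>0" and K: "krull_valuation \<mu>"
    and ext: "\<And>a. \<mu> (to_fract [:a:]) = \<nu>\<^sub>0 a"
  shows "residue_embedding \<mu> \<in> ring_hom (residue_field \<nu>\<^sub>0) (residue_field \<mu>)"
proof -
  interpret I0: maximalideal "valuation_ideal \<nu>\<^sub>0" "valuation_ring \<nu>\<^sub>0"
    using K0 by (rule valuation_ideal_maximal)
  interpret I: maximalideal "valuation_ideal \<mu>" "valuation_ring \<mu>"
    using K by (rule valuation_ideal_maximal)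
  note emb = residue_embedding_coset[OF K0 K ext]
  have cos: "\<exists>a. 0 \<le> \<nu>\<^sub>0 a \<and> x = valuation_ideal \<nu>\<^sub>0 +>\<^bsub>valuation_ring \<nu>\<^sub>0\<^esub> a"
    if "x \<in> carrier (residue_field \<nu>\<^sub>0)" for x
    using that by (auto simp: residue_field_def FactRing_def A_RCOSETS_def')
  have closed: "0 \<le> \<nu>\<^sub>0 (a + b)" "0 \<le> \<nu>\<^sub>0 (a * b)" if "0 \<le> \<nu>\<^sub>0 a" "0 \<le> \<nu>\<^sub>0 b" for a b
    using I0.a_closed[of a b] I0.m_closed[of a b] that by auto
  have mem: "to_fract [:a:] \<in> carrier (valuation_ring \<mu>)" if "0 \<le> \<nu>\<^sub>0 a" for a
    using that ext by simp
  have hom: "to_fract [:a * b:] = to_fract [:a:] * to_fract [:b:]"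
    "to_fract [:a + b:] = to_fract [:a:] + to_fract [:b:]" for a b :: 'a
    by (simp_all flip: to_fract_mult to_fract_add)
  show ?thesis
  proof (rule ring_hom_memI)
    fix x assume "x \<in> carrier (residue_field \<nu>\<^sub>0)"
    then obtain a where a: "0 \<le> \<nu>\<^sub>0 a" "x = valuation_ideal \<nu>\<^sub>0 +>\<^bsub>valuation_ring \<nu>\<^sub>0\<^esub> a"
      using cos by blast
    then show "residue_embedding \<mu> x \<in> carrier (residue_field \<mu>)"
      using mem by (auto simp: emb residue_field_def FactRing_def A_RCOSETS_def')
    fix y assume "y \<in> carrier (residue_field \<nu>\<^sub>0)"
    then obtain b where b: "0 \<le> \<nu>\<^sub>0 b" "y = valuation_ideal \<nu>\<^sub>0 +>\<^bsub>valuation_ring \<nu>\<^sub>0\<^esub> b"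
      using cos by blast
    show "residue_embedding \<mu> (x \<otimes>\<^bsub>residue_field \<nu>\<^sub>0\<^esub> y) =
        residue_embedding \<mu> x \<otimes>\<^bsub>residue_field \<mu>\<^esub> residue_embedding \<mu> y"
      using a b mem closed
      by (simp add: emb hom residue_field_def FactRing_def I0.rcoset_mult_add I.rcoset_mult_add)
    show "residue_embedding \<mu> (x \<oplus>\<^bsub>residue_field \<nu>\<^sub>0\<^esub> y) =
        residue_embedding \<mu> x \<oplus>\<^bsub>residue_field \<mu>\<^esub> residue_embedding \<mu> y"
      using a b mem closed
      by (simp add: emb hom residue_field_def FactRing_def I0.a_rcos_sum I.a_rcos_sum)
  next
    have "0 \<le> \<nu>\<^sub>0 1"
      using K0 by (simp add: krull_valuation_def valuation_def)
    then show "residue_embedding \<mu> \<one>\<^bsub>residue_field \<nu>\<^sub>0\<^esub> = \<one>\<^bsub>residue_field \<mu>\<^esub>"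
      by (simp add: emb residue_field_def FactRing_def flip: one_pCons)
  qed
qed

end

theory Submission
  imports Defs
begin

text \<open>
  The chain consists of the truncations of \<open>\<nu>\<close> at key polynomials.  The truncation of \<open>\<nu>\<close> at a
  nonconstant polynomial \<open>Q\<close> expands \<open>f = \<Sum> f\<^sub>i Q\<^sup>i\<close> with \<open>deg f\<^sub>i < deg Q\<close> and returns
  \<open>min \<nu>(f\<^sub>i Q\<^sup>i)\<close>; it lies below \<open>\<nu>\<close> and agrees with \<open>\<nu>\<close> in degrees less than \<open>deg Q\<close>.  A key
  polynomial is taken here to be a monic nonconstant \<open>Q\<close> such that reducing a product \<open>a b\<close> of two
  polynomials of smaller degree modulo \<open>Q\<close> does not change its value.  This makes Gauss's
  argument work: the product of two leading digits contributes a digit of exactly the expected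
  value, so the truncation is multiplicative (\<open>truncation_mult\<close>).

  Since the truncation at \<open>Q\<close> is the least valuation that dominates \<open>\<nu>\<close> on \<open>Q\<close> and in degrees
  less than \<open>deg Q\<close>, any two truncations at key polynomials are comparable: order the key
  polynomials by degree and then by value (\<open>truncation_chain\<close>).

  Every \<open>f\<close> has the same value under \<open>\<nu>\<close> and under some truncation (\<open>truncation_exact\<close>), by
  induction on the degree.  A key polynomial \<open>f\<close> works for itself.  If a monic \<open>f\<close> is not a key
  polynomial, then some product \<open>a b = s f + r\<close> of polynomials of smaller degree satisfies
  \<open>\<nu>(r) \<noteq> \<nu>(a b)\<close>, so \<open>\<nu>(s f)\<close> is the smaller of these two values.  As truncations form a chain, a
  single one is exact on \<open>a\<close>, \<open>b\<close>, \<open>s\<close> and \<open>r\<close>; the same computation for it shows that it is exact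
  on \<open>s f\<close>, hence on \<open>f\<close>.  Exactness passes to all larger truncations, so every \<open>f\<close> is stable and
  the supremum is \<open>\<nu>\<close>.

  Because values are torsion modulo those of the base field, some power \<open>Q\<^sup>m\<close> has the value of a
  constant \<open>c\<close>.  The class of \<open>Q\<^sup>m / c\<close> is transcendental: distinct powers of \<open>Q\<close> occupy distinct
  digits, so a combination of powers of \<open>Q\<^sup>m / c\<close> with constant coefficients has the least of the
  values of the coefficients (\<open>truncation_residue_transcendental\<close>).  Finally, a greatest member of
  the chain would be exact everywhere, hence equal to \<open>\<nu>\<close>, which is not residue-transcendental.
\<close>

section \<open>Values and valuations\<close>

lemma top_add_less_mono:
  fixes x y z :: "'g::linordered_ab_group_add top"
  assumes "x < y" and "z \<noteq> infty"
  shows "x + z < y + z"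
  using assms by (cases x; cases y; cases z) auto

lemma top_add_left_cancel:
  fixes x y z :: "'g::linordered_ab_group_add top"
  assumes "x \<noteq> infty" and "x + y = x + z"
  shows "y = z"
  using assms by (cases x; cases y; cases z) auto

lemma top_add_eq_infty_iff:
  fixes x y :: "'g::linordered_ab_group_add top"
  shows "x + y = infty \<longleftrightarrow> x = infty \<or> y = infty"
  by (cases x; cases y) auto

lemma top_min_add_distrib:
  fixes x y z :: "'g::linordered_ab_group_add top"
  shows "z + min x y = min (z + x) (z + y)"
  using add_left_mono[of x y z] add_left_mono[of y x z]
  by (cases "x \<le> y") (auto simp: min_def)

lemma valuation_mult: "valuation \<nu> \<Longrightarrow> \<nu> (a * b) = \<nu> a + \<nu> b"
  by (simp add: valuation_def)

lemma valuation_add: "valuation \<nu> \<Longrightarrow> min (\<nu> a) (\<nu> b) \<le> \<nu> (a + b)"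
  by (simp add: valuation_def)

lemma valuation_zero: "valuation \<nu> \<Longrightarrow> \<nu> 0 = infty"
  by (simp add: valuation_def)

lemma valuation_diff: "valuation \<nu> \<Longrightarrow> min (\<nu> a) (\<nu> b) \<le> \<nu> (a - b)"
  using valuation_add[of \<nu> a "- b"] valuation_uminus[of \<nu> b] by simp

lemma valuation_diff_eq:
  assumes "valuation \<nu>" and "\<nu> a < \<nu> b"
  shows "\<nu> (a - b) = \<nu> a"
proof (rule antisym)
  show "\<nu> a \<le> \<nu> (a - b)"
    using valuation_diff[OF assms(1), of a b] assms(2) by simp
  show "\<nu> (a - b) \<le> \<nu> a"
    using valuation_add[OF assms(1), of "a - b" b] assms(2) by (auto simp: min_le_iff_disj)
qed

section \<open>Truncations\<close>

text \<open>The recursion reads the \<open>Q\<close>-adic digits one at a time; unfolded, it is the minimum of the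
  values \<open>\<nu> (f\<^sub>i * Q ^ i)\<close>.  For constant \<open>Q\<close>, where there are no digits, it defaults to \<open>\<nu>\<close>.\<close>

function truncation ::
    "('k::field poly \<Rightarrow> 'g::linordered_ab_group_add top) \<Rightarrow> 'k poly \<Rightarrow> 'k poly \<Rightarrow> 'g top" where
  "truncation \<nu> Q f =
     (if Polynomial.degree f < Polynomial.degree Q \<or> Polynomial.degree Q = 0 then \<nu> f
      else min (\<nu> (f mod Q)) (\<nu> Q + truncation \<nu> Q (f div Q)))"
  by auto
termination
proof (relation "Wellfounded.measure (\<lambda>(\<nu>, Q, f). Polynomial.degree f)")
  fix \<nu> :: "'a poly \<Rightarrow> 'b top" and Q f :: "'a poly"
  assume "\<not> (Polynomial.degree f < Polynomial.degree Q \<or> Polynomial.degree Q = 0)"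
  then have "Polynomial.degree (f div Q) < Polynomial.degree f"
    by (intro degree_div_less) auto
  then show "((\<nu>, Q, f div Q), \<nu>, Q, f) \<in> Wellfounded.measure (\<lambda>(\<nu>, Q, f). Polynomial.degree f)"
    by simp
qed auto

declare truncation.simps [simp del]

lemma truncation_small:
  "Polynomial.degree f < Polynomial.degree Q \<Longrightarrow> truncation \<nu> Q f = \<nu> f"
  by (simp add: truncation.simps)

lemma truncation_rec:
  assumes "valuation \<nu>" and "0 < Polynomial.degree Q"
  shows "truncation \<nu> Q f = min (\<nu> (f mod Q)) (\<nu> Q + truncation \<nu> Q (f div Q))"
proof (cases "Polynomial.degree f < Polynomial.degree Q")
  case True
  then have "f div Q = 0" "f mod Q = f"
    by (simp_all add: div_poly_less mod_poly_less)
  moreover have "\<nu> Q + infty = infty"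
    by (simp add: top_add_eq_infty_iff)
  ultimately show ?thesis
    using True assms by (simp add: truncation_small valuation_zero min_def)
next
  case False
  then show ?thesis
    using assms by (subst truncation.simps) simp
qed

lemma adic_div_mod:
  fixes a f Q :: "'k::field poly"
  assumes "Polynomial.degree a < Polynomial.degree Q"
  shows "(a + Q * f) div Q = f" "(a + Q * f) mod Q = a"
  using assms by (auto simp: poly_div_add_left poly_mod_add_left div_poly_less mod_poly_less)

lemma degree_mod_lt:
  fixes f Q :: "'k::field poly"
  shows "0 < Polynomial.degree Q \<Longrightarrow> Polynomial.degree (f mod Q) < Polynomial.degree Q"
  using degree_mod_less[of Q f] by (cases "Q = 0") auto

lemma degree_product_div_lt:
  fixes a b Q :: "'k::field poly"
  assumes "Polynomial.degree a < Polynomial.degree Q" and "Polynomial.degree b < Polynomial.degree Q"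
  shows "Polynomial.degree (a * b div Q) < Polynomial.degree Q"
proof (cases "a * b div Q = 0")
  case False
  have "Polynomial.degree (a * b mod Q) < Polynomial.degree Q"
    using assms by (intro degree_mod_lt) simp
  also have "\<dots> \<le> Polynomial.degree (a * b div Q * Q)"
    using False assms by (subst degree_mult_eq) auto
  finally have "Polynomial.degree (a * b) = Polynomial.degree (a * b div Q * Q)"
    using degree_add_eq_left[of "a * b mod Q" "a * b div Q * Q"] by simp
  also have "\<dots> = Polynomial.degree (a * b div Q) + Polynomial.degree Q"
    using False assms by (intro degree_mult_eq) auto
  finally show ?thesis
    using assms degree_mult_le[of a b] by linarith
qed (use assms in simp)

text \<open>Induction on the number of digits.\<close>

lemma adic_induct [consumes 1, case_names zero step]:
  fixes Q f :: "'k::field poly"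
  assumes deg: "0 < Polynomial.degree Q" and zero: "P 0"
    and step: "\<And>a f. Polynomial.degree a < Polynomial.degree Q \<Longrightarrow> P f \<Longrightarrow> P (a + Q * f)"
  shows "P f"
proof (induction "Polynomial.degree f" arbitrary: f rule: less_induct)
  case less
  have *: "Polynomial.degree (f mod Q) < Polynomial.degree Q"
    using deg by (rule degree_mod_lt)
  have eq: "f mod Q + Q * (f div Q) = f" by simp
  have "P (f div Q)"
  proof (cases "Polynomial.degree f < Polynomial.degree Q")
    case True
    then show ?thesis using zero by (simp add: div_poly_less)
  next
    case False
    then show ?thesis using deg by (intro less degree_div_less) auto
  qed
  then show ?case using step[OF *] eq by metis
qed

context
  fixes \<nu> :: "'k::field poly \<Rightarrow> 'g::linordered_ab_group_add top" and Q :: "'k poly"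
  assumes val: "valuation \<nu>" and deg: "0 < Polynomial.degree Q"
begin

lemma truncation_step:
  assumes "Polynomial.degree a < Polynomial.degree Q"
  shows "truncation \<nu> Q (a + Q * f) = min (\<nu> a) (\<nu> Q + truncation \<nu> Q f)"
  using truncation_rec[OF val deg, of "a + Q * f"] by (simp only: adic_div_mod[OF assms])

lemma truncation_zero: "truncation \<nu> Q 0 = infty"
  using deg val by (simp add: truncation_small valuation_zero)

lemma truncation_times_key: "truncation \<nu> Q (Q * f) = \<nu> Q + truncation \<nu> Q f"
  using truncation_step[of 0 f] deg val
  by (simp add: valuation_zero min_def) (metis less_eq_top_is_Top)

lemma truncation_times_key_power: "truncation \<nu> Q (Q ^ i * f) = \<nu> (Q ^ i) + truncation \<nu> Q f"
proof (induction i)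
  case (Suc i)
  then show ?case
    using truncation_times_key[of "Q ^ i * f"] valuation_mult[OF val, of Q "Q ^ i"]
    by (simp add: ac_simps)
qed (use val in \<open>simp add: valuation_def\<close>)

lemma truncation_le: "truncation \<nu> Q f \<le> \<nu> f"
  using deg
proof (induction f rule: adic_induct)
  case (step a f)
  have "truncation \<nu> Q (a + Q * f) \<le> min (\<nu> a) (\<nu> (Q * f))"
    using step add_left_mono[OF step(2), of "\<nu> Q"]
    by (auto simp: truncation_step valuation_mult[OF val] min_le_iff_disj)
  then show ?case using valuation_add[OF val] order_trans by blast
qed (simp add: val valuation_zero)

lemma truncation_uminus: "truncation \<nu> Q (- f) = truncation \<nu> Q f"
  using deg
proof (induction f rule: adic_induct)
  case (step a f)
  then show ?case
    using truncation_step[of "- a" "- f"] valuation_uminus[OF val]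
    by (simp add: truncation_step)
qed simp

lemma truncation_add: "min (truncation \<nu> Q f) (truncation \<nu> Q g) \<le> truncation \<nu> Q (f + g)"
  using deg
proof (induction f arbitrary: g rule: adic_induct)
  case (step a f)
  define b h where "b = g mod Q" and "h = g div Q"
  have b: "Polynomial.degree b < Polynomial.degree Q"
    using deg by (simp add: b_def degree_mod_lt)
  have g: "g = b + Q * h" by (simp add: b_def h_def)
  have ab: "Polynomial.degree (a + b) < Polynomial.degree Q"
    using step(1) b by (rule degree_add_less)
  have eq: "a + Q * f + g = (a + b) + Q * (f + h)"
    by (simp add: g algebra_simps)
  have "min (\<nu> Q + truncation \<nu> Q f) (\<nu> Q + truncation \<nu> Q h) \<le> \<nu> Q + truncation \<nu> Q (f + h)"
    using add_left_mono[OF step(2)] by (simp flip: top_min_add_distrib)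
  then show ?case
    unfolding eq truncation_step[OF ab] unfolding g truncation_step[OF b] truncation_step[OF step(1)]
    using valuation_add[OF val, of a b] by (auto simp: min_le_iff_disj)
qed (simp add: min_le_iff_disj)

text \<open>The ultrametric inequality in the form needed to discard summands of large value.\<close>

lemma truncation_add_le:
  assumes "truncation \<nu> Q f \<le> S" and "S < truncation \<nu> Q g"
  shows "truncation \<nu> Q (f + g) \<le> S"
  using truncation_add[of "f + g" "- g"] assms by (auto simp: truncation_uminus min_le_iff_disj)

end

section \<open>Key polynomials\<close>

text \<open>Instead of a condition on derivatives or on graded algebras, the definition demands the single
  property that makes truncations multiplicative.  It forces \<open>\<nu> (a * b div Q * Q) \<ge> \<nu> (a * b)\<close>,
  because the left-hand side is the value of \<open>a * b - a * b mod Q\<close>.\<close>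

definition key_polynomial ::
    "('k::field poly \<Rightarrow> 'g::linordered_ab_group_add top) \<Rightarrow> 'k poly \<Rightarrow> bool" where
  "key_polynomial \<nu> Q \<longleftrightarrow> Polynomial.lead_coeff Q = 1 \<and> 0 < Polynomial.degree Q \<and>
     (\<forall>a b. Polynomial.degree a < Polynomial.degree Q \<longrightarrow> Polynomial.degree b < Polynomial.degree Q \<longrightarrow>
        \<nu> (a * b mod Q) = \<nu> (a * b))"

context
  fixes \<nu> :: "'k::field poly \<Rightarrow> 'g::linordered_ab_group_add top" and Q :: "'k poly"
  assumes val: "valuation \<nu>" and key: "key_polynomial \<nu> Q"
begin

lemma key_deg: "0 < Polynomial.degree Q"
  using key by (simp add: key_polynomial_def)

lemmas trunc_facts = truncation_step[OF val key_deg] truncation_zero[OF val key_deg]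
  truncation_times_key[OF val key_deg] truncation_times_key_power[OF val key_deg]

text \<open>The product of two digits has at most two digits, since its degree is below \<open>2 * degree Q\<close>; the
  key property says that the lower one already has the value of the product.\<close>

lemma truncation_mult_small:
  assumes a: "Polynomial.degree a < Polynomial.degree Q" and b: "Polynomial.degree b < Polynomial.degree Q"
  shows "truncation \<nu> Q (a * b) = \<nu> a + \<nu> b"
proof -
  define r s where "r = a * b mod Q" and "s = a * b div Q"
  have r: "Polynomial.degree r < Polynomial.degree Q" "\<nu> r = \<nu> (a * b)"
    using key_deg key a b by (auto simp: r_def key_polynomial_def degree_mod_lt)
  have ab: "a * b = r + Q * s" by (simp add: r_def s_def)
  have "Polynomial.degree s < Polynomial.degree Q"
    unfolding s_def using a b by (rule degree_product_div_lt)
  then have "truncation \<nu> Q (a * b) = min (\<nu> r) (\<nu> (Q * s))"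
    using r(1) by (simp add: ab trunc_facts truncation_small valuation_mult[OF val])
  moreover have "\<nu> r \<le> \<nu> (Q * s)"
    using valuation_diff[OF val, of "a * b" r] r(2) by (simp add: ab)
  ultimately show ?thesis
    using r(2) by (simp add: valuation_mult[OF val])
qed

lemma truncation_mult_ge_small:
  assumes a: "Polynomial.degree a < Polynomial.degree Q"
  shows "\<nu> a + truncation \<nu> Q g \<le> truncation \<nu> Q (a * g)"
  using key_deg
proof (induction g rule: adic_induct)
  case (step b g)
  have "\<nu> a + truncation \<nu> Q (b + Q * g) = min (\<nu> a + \<nu> b) (\<nu> a + (\<nu> Q + truncation \<nu> Q g))"
    by (simp add: trunc_facts step top_min_add_distrib)
  also have "\<dots> \<le> min (truncation \<nu> Q (a * b)) (truncation \<nu> Q (Q * (a * g)))"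
    using add_left_mono[OF step(2), of "\<nu> Q"]
    by (intro min.mono) (simp_all add: truncation_mult_small a step trunc_facts ac_simps)
  also have "\<dots> \<le> truncation \<nu> Q (a * b + Q * (a * g))"
    by (rule truncation_add[OF val key_deg])
  finally show ?case by (simp add: algebra_simps)
qed (simp add: trunc_facts)

lemma truncation_mult_ge: "truncation \<nu> Q f + truncation \<nu> Q g \<le> truncation \<nu> Q (f * g)"
  using key_deg
proof (induction f rule: adic_induct)
  case (step a f)
  have "truncation \<nu> Q (a + Q * f) + truncation \<nu> Q g
      = min (\<nu> a + truncation \<nu> Q g) (\<nu> Q + (truncation \<nu> Q f + truncation \<nu> Q g))"
    using top_min_add_distrib[of "truncation \<nu> Q g" "\<nu> a" "\<nu> Q + truncation \<nu> Q f"]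
    by (simp add: trunc_facts step ac_simps)
  also have "\<dots> \<le> min (truncation \<nu> Q (a * g)) (truncation \<nu> Q (Q * (f * g)))"
    using add_left_mono[OF step(2), of "\<nu> Q"]
    by (intro min.mono) (simp_all add: truncation_mult_ge_small step trunc_facts)
  also have "\<dots> \<le> truncation \<nu> Q (a * g + Q * (f * g))"
    by (rule truncation_add[OF val key_deg])
  finally show ?case by (simp add: algebra_simps)
qed (simp add: trunc_facts)

text \<open>Split off the digits below the first one at which the minimum is attained: they form \<open>u\<close>, and
  the lowest digit of \<open>h\<close> attains the minimum for \<open>h\<close>.\<close>

lemma truncation_leading_digit:
  assumes "truncation \<nu> Q f \<noteq> infty"
  shows "\<exists>u i h. f = u + Q ^ i * h \<and> truncation \<nu> Q f < truncation \<nu> Q u \<and>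
    truncation \<nu> Q f = truncation \<nu> Q (Q ^ i * h) \<and> truncation \<nu> Q h = \<nu> (h mod Q)"
  using key_deg assms
proof (induction f rule: adic_induct)
  case (step a f)
  let ?w = "truncation \<nu> Q"
  have w: "?w (a + Q * f) = min (\<nu> a) (\<nu> Q + ?w f)"
    using step(1) by (rule trunc_facts)
  show ?case
  proof (cases "\<nu> a \<le> \<nu> Q + ?w f")
    case True
    then show ?thesis
      using step(3) w adic_div_mod[OF step(1), of f]
      by (intro exI[of _ 0] exI[of _ "a + Q * f"]) (cases "\<nu> a"; simp add: trunc_facts)
  next
    case False
    then have "\<nu> Q + ?w f \<noteq> infty"
      by auto
    then have fin: "?w f \<noteq> infty" "\<nu> Q \<noteq> infty"
      by (simp_all add: top_add_eq_infty_iff)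
    have w': "?w (a + Q * f) = \<nu> Q + ?w f"
      using w False by simp
    obtain u i h where u: "f = u + Q ^ i * h" "?w f < ?w u" "?w f = ?w (Q ^ i * h)" "?w h = \<nu> (h mod Q)"
      using step(2)[OF fin(1)] by blast
    have "\<nu> Q + ?w f < ?w (a + Q * u)"
      using False top_add_less_mono[OF u(2) fin(2)] step(1) by (simp add: trunc_facts add.commute)
    moreover have "a + Q * f = (a + Q * u) + Q ^ Suc i * h"
      by (simp add: u(1) algebra_simps)
    moreover have "?w (Q ^ Suc i * h) = \<nu> Q + ?w f"
      using trunc_facts(3)[of "Q ^ i * h"] u(3) by (simp add: ac_simps)
    ultimately show ?thesis
      using u(4) w' by metis
  qed
qed (simp add: trunc_facts)

text \<open>Gauss's argument: after discarding the parts of strictly larger value, the lowest digit of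
  \<open>h * k\<close> is the reduction of the product of the lowest digits, and it bounds the truncation from
  above.\<close>

lemma truncation_mult: "truncation \<nu> Q (f * g) = truncation \<nu> Q f + truncation \<nu> Q g"
proof (rule antisym[OF _ truncation_mult_ge])
  let ?w = "truncation \<nu> Q"
  let ?S = "?w f + ?w g"
  show "?w (f * g) \<le> ?S"
  proof (cases "?w f = infty \<or> ?w g = infty")
    case True
    then have "?S = infty" by (simp add: top_add_eq_infty_iff)
    then show ?thesis by simp
  next
    case False
    then obtain u i h where u: "f = u + Q ^ i * h" "?w f < ?w u" "?w f = ?w (Q ^ i * h)"
        "?w h = \<nu> (h mod Q)"
      using truncation_leading_digit by blast
    from False obtain v j k where v: "g = v + Q ^ j * k" "?w g < ?w v" "?w g = ?w (Q ^ j * k)"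
        "?w k = \<nu> (k mod Q)"
      using truncation_leading_digit by blast
    have small: "Polynomial.degree (p mod Q) < Polynomial.degree Q" for p
      using key_deg by (rule degree_mod_lt)
    have "?w (h * k) \<le> \<nu> (h * k mod Q)"
      using truncation_rec[OF val key_deg, of "h * k"] by simp
    also have "h * k mod Q = (h mod Q) * (k mod Q) mod Q"
      by (simp add: mod_mult_eq)
    also have "\<nu> \<dots> = ?w h + ?w k"
      using key small u(4) v(4) by (simp add: key_polynomial_def valuation_mult[OF val])
    finally have "\<nu> (Q ^ (i + j)) + ?w (h * k) \<le> \<nu> (Q ^ (i + j)) + (?w h + ?w k)"
      by (rule add_left_mono)
    then have lead: "?w (Q ^ (i + j) * (h * k)) \<le> ?S"
      unfolding u(3) v(3) trunc_facts(4)
      by (simp add: power_add valuation_mult[OF val] ac_simps)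
    have "?S < ?w u + ?w g"
      using top_add_less_mono[OF u(2)] False by simp
    also have "\<dots> \<le> ?w (u * g)"
      by (rule truncation_mult_ge)
    finally have 1: "?S < ?w (u * g)" .
    have "?S < ?w v + ?w (Q ^ i * h)"
      using top_add_less_mono[OF v(2), of "?w f"] False by (simp add: u(3) add.commute)
    also have "\<dots> \<le> ?w (v * (Q ^ i * h))"
      by (rule truncation_mult_ge)
    finally have 2: "?S < ?w (v * (Q ^ i * h))" .
    have "f * g = (Q ^ (i + j) * (h * k) + v * (Q ^ i * h)) + u * g"
      by (simp add: u(1) v(1) power_add algebra_simps)
    then show ?thesis
      using truncation_add_le[OF val key_deg truncation_add_le[OF val key_deg lead 2] 1] by simp
  qed
qed

lemma truncation_const: "truncation \<nu> Q [:c:] = \<nu> [:c:]"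
  using key_deg by (simp add: truncation_small)

lemma truncation_valuation: "valuation (truncation \<nu> Q)"
  unfolding valuation_def
  using truncation_mult truncation_add[OF val key_deg] trunc_facts truncation_const[of 1] val
  by (auto simp: valuation_def one_pCons)

lemma truncation_key: "truncation \<nu> Q Q = \<nu> Q"
  using trunc_facts(3)[of 1] truncation_const[of 1] val by (simp add: valuation_def one_pCons)

text \<open>A valuation that dominates \<open>\<nu>\<close> on digits and on \<open>Q\<close> dominates it on each term of the \<open>Q\<close>-adic
  expansion, so the ultrametric inequality bounds it from below by the truncation.\<close>

lemma truncation_least:
  assumes w: "valuation w" and small: "\<And>a. Polynomial.degree a < Polynomial.degree Q \<Longrightarrow> \<nu> a \<le> w a"
    and Q: "\<nu> Q \<le> w Q"
  shows "truncation \<nu> Q \<le> w"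
proof (rule le_funI)
  fix f
  show "truncation \<nu> Q f \<le> w f"
    using key_deg
  proof (induction f rule: adic_induct)
    case (step a f)
    have "min (\<nu> a) (\<nu> Q + truncation \<nu> Q f) \<le> min (w a) (w (Q * f))"
      using small step Q by (intro min.mono) (auto simp: valuation_mult[OF w] add_mono)
    then show ?case
      using valuation_add[OF w, of a "Q * f"] step(1) by (simp only: trunc_facts)
  qed (simp add: w valuation_zero)
qed

end

text \<open>By minimality it is enough to compare on digits of \<open>Q\<close>, where the truncation at \<open>R\<close> is exact,
  and on \<open>Q\<close> itself.  In equal degrees \<open>Q - R\<close> has smaller degree, both polynomials being monic, and
  its value is at least \<open>\<nu> Q\<close>.\<close>

lemma truncation_mono_key:
  assumes val: "valuation \<nu>" and Q: "key_polynomial \<nu> Q" and R: "key_polynomial \<nu> R"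
    and le: "Polynomial.degree Q < Polynomial.degree R \<or>
      Polynomial.degree Q = Polynomial.degree R \<and> \<nu> Q \<le> \<nu> R"
  shows "truncation \<nu> Q \<le> truncation \<nu> R"
proof (rule truncation_least[OF val Q truncation_valuation[OF val R]])
  fix a :: "'a poly" assume "Polynomial.degree a < Polynomial.degree Q"
  then show "\<nu> a \<le> truncation \<nu> R a"
    using le by (subst truncation_small) auto
next
  show "\<nu> Q \<le> truncation \<nu> R Q"
  proof (cases "Polynomial.degree Q < Polynomial.degree R")
    case False
    then have eq: "Polynomial.degree Q = Polynomial.degree R" "\<nu> Q \<le> \<nu> R"
      using le by auto
    have "Polynomial.degree (Q - R) < Polynomial.degree R"
    proof (rule degree_lessI)
      show "\<forall>k\<ge>Polynomial.degree R. Polynomial.coeff (Q - R) k = 0"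
        using Q R eq by (auto simp: key_polynomial_def order_le_less coeff_eq_0)
    qed (use R in \<open>auto simp: key_polynomial_def\<close>)
    then have "truncation \<nu> R (Q - R) = \<nu> (Q - R)"
      by (rule truncation_small)
    moreover have "\<nu> Q \<le> \<nu> (Q - R)"
      using valuation_diff[OF val, of Q R] eq(2) by (simp add: min_def)
    moreover have "min (truncation \<nu> R R) (truncation \<nu> R (Q - R)) \<le> truncation \<nu> R Q"
      using valuation_add[OF truncation_valuation[OF val R], of R "Q - R"] by simp
    ultimately show ?thesis
      using eq(2) truncation_key[OF val R] by (auto simp: min_le_iff_disj)
  qed (simp add: truncation_small)
qed

lemma truncation_chain:
  assumes "valuation \<nu>" and "key_polynomial \<nu> Q" and "key_polynomial \<nu> R"
  shows "truncation \<nu> Q \<le> truncation \<nu> R \<or> truncation \<nu> R \<le> truncation \<nu> Q"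
  using truncation_mono_key[OF assms] truncation_mono_key[OF assms(1,3,2)]
  by (metis linorder_cases linear)

section \<open>Truncations recover the valuation\<close>

lemma key_polynomial_X: "valuation \<nu> \<Longrightarrow> key_polynomial \<nu> [:0, 1:]"
  by (auto simp: key_polynomial_def mod_poly_less elim!: degree_eq_zeroE)

text \<open>Among finitely many truncations the largest inherits exactness from the others, because all of
  them lie below \<open>\<nu>\<close>.\<close>

lemma truncation_exact_finite:
  assumes val: "valuation \<nu>" and "finite F"
    and "\<And>f. f \<in> F \<Longrightarrow> \<exists>Q. key_polynomial \<nu> Q \<and> truncation \<nu> Q f = \<nu> f"
  shows "\<exists>Q. key_polynomial \<nu> Q \<and> (\<forall>f\<in>F. truncation \<nu> Q f = \<nu> f)"
  using assms(2,3)
proof (induction F)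
  case empty
  then show ?case using key_polynomial_X[OF val] by auto
next
  case (insert f F)
  then obtain Q where Q: "key_polynomial \<nu> Q" "\<forall>f\<in>F. truncation \<nu> Q f = \<nu> f"
    by blast
  obtain R where R: "key_polynomial \<nu> R" "truncation \<nu> R f = \<nu> f"
    using insert(4) by blast
  have up: "truncation \<nu> T g = \<nu> g"
    if "truncation \<nu> S \<le> truncation \<nu> T" "truncation \<nu> S g = \<nu> g" "key_polynomial \<nu> T" for S T g
  proof -
    have "0 < Polynomial.degree T" using that(3) by (simp add: key_polynomial_def)
    then show ?thesis
      using truncation_le[OF val] that(1,2) by (metis antisym le_funD)
  qed
  consider "truncation \<nu> Q \<le> truncation \<nu> R" | "truncation \<nu> R \<le> truncation \<nu> Q"
    using truncation_chain[OF val Q(1) R(1)] by blast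
  then show ?case
  proof cases
    case 1
    then show ?thesis using up[OF 1 _ R(1)] Q R by (intro exI[of _ R]) auto
  next
    case 2
    then show ?thesis using up[OF 2 _ Q(1)] Q R by (intro exI[of _ Q]) auto
  qed
qed

text \<open>If \<open>p\<close> and \<open>r\<close> have different values, then \<open>a * f = p - r\<close> has the smaller one, both for \<open>\<nu>\<close> and
  for \<open>w\<close>; the finite value of \<open>a\<close> cancels.\<close>

lemma krull_exact_from_relation:
  assumes K: "krull_valuation \<nu>" and w: "valuation w"
    and eq: "p = a * f + r" and exact: "w p = \<nu> p" "w a = \<nu> a" "w r = \<nu> r"
    and neq: "\<nu> r \<noteq> \<nu> p"
  shows "w f = \<nu> f"
proof -
  have v: "valuation \<nu>" using K by (simp add: krull_valuation_def)
  have af: "a * f = p - r" using eq by simp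
  have "w (a * f) = \<nu> (a * f)"
  proof (cases "\<nu> p < \<nu> r")
    case True
    then show ?thesis
      using valuation_diff_eq[OF v, of p r] valuation_diff_eq[OF w, of p r] exact af by simp
  next
    case False
    then have "\<nu> r < \<nu> p" using neq by simp
    then have "\<nu> (r - p) = \<nu> r" "w (r - p) = w r"
      using valuation_diff_eq[OF v, of r p] valuation_diff_eq[OF w, of r p] exact by simp_all
    then show ?thesis
      using valuation_uminus[OF v, of "r - p"] valuation_uminus[OF w, of "r - p"] exact af by simp
  qed
  moreover have "\<nu> a \<noteq> infty"
    \<comment> \<open>otherwise \<open>a = 0\<close> and \<open>p = r\<close>\<close>
    using K neq eq by (auto simp: krull_valuation_def)
  ultimately show ?thesis
    using exact(2) top_add_left_cancel[of "\<nu> a" "w f" "\<nu> f"]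
    by (simp add: valuation_mult[OF v] valuation_mult[OF w])
qed

text \<open>A polynomial that is not a key polynomial carries a witness of this failure, and the witness is
  exactly a relation from which its value can be read off in lower degrees.\<close>

lemma truncation_exact:
  assumes K: "krull_valuation \<nu>"
  shows "\<exists>Q. key_polynomial \<nu> Q \<and> truncation \<nu> Q f = \<nu> f"
proof (induction "Polynomial.degree f" arbitrary: f rule: less_induct)
  case less
  have v: "valuation \<nu>" using K by (simp add: krull_valuation_def)
  show ?case
  proof (cases "Polynomial.degree f = 0")
    case True
    then show ?thesis
      using key_polynomial_X[OF v] by (intro exI[of _ "[:0, 1:]"]) (simp add: truncation_small)
  next
    case False
    \<comment> \<open>Key polynomials are monic, so divide by the leading coefficient first.\<close>
    define c where "c = Polynomial.lead_coeff f"
    define g where "g = Polynomial.smult (inverse c) f"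
    have c: "c \<noteq> 0" using False by (auto simp: c_def)
    have g: "Polynomial.degree g = Polynomial.degree f" "Polynomial.lead_coeff g = 1" "f = [:c:] * g"
      using c by (simp_all add: g_def c_def)
    have "\<exists>Q. key_polynomial \<nu> Q \<and> truncation \<nu> Q g = \<nu> g"
    proof (cases "key_polynomial \<nu> g")
      case True
      then show ?thesis using truncation_key[OF v True] by blast
    next
      case False
      then obtain a b where ab: "Polynomial.degree a < Polynomial.degree g"
          "Polynomial.degree b < Polynomial.degree g" "\<nu> (a * b mod g) \<noteq> \<nu> (a * b)"
        using g \<open>Polynomial.degree f \<noteq> 0\<close> by (auto simp: key_polynomial_def)
      define r s where "r = a * b mod g" and "s = a * b div g"
      have r: "Polynomial.degree r < Polynomial.degree g"
        unfolding r_def using ab(1) by (intro degree_mod_lt) simp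
      have s: "Polynomial.degree s < Polynomial.degree g"
        unfolding s_def using ab(1,2) by (rule degree_product_div_lt)
      obtain Q where Q: "key_polynomial \<nu> Q" "\<forall>p\<in>{a, b, r, s}. truncation \<nu> Q p = \<nu> p"
        using truncation_exact_finite[OF v, of "{a, b, r, s}"] less ab r s g(1) by auto
      have w: "valuation (truncation \<nu> Q)"
        using v Q(1) by (rule truncation_valuation)
      have "truncation \<nu> Q g = \<nu> g"
      proof (rule krull_exact_from_relation[OF K w])
        show "a * b = s * g + r" by (simp add: r_def s_def)
        show "truncation \<nu> Q (a * b) = \<nu> (a * b)"
          using Q(2) by (simp add: valuation_mult[OF w] valuation_mult[OF v])
      qed (use Q ab in \<open>auto simp: r_def\<close>)
      then show ?thesis using Q(1) by blast
    qed
    then obtain Q where Q: "key_polynomial \<nu> Q" "truncation \<nu> Q g = \<nu> g" by blast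
    then have "truncation \<nu> Q f = \<nu> f"
      using truncation_mult[OF v Q(1)] truncation_const[OF v Q(1)] by (simp add: g(3) valuation_mult[OF v] del: mult_pCons_left)
    then show ?thesis using Q(1) by blast
  qed
qed

section \<open>Torsion of the value group\<close>

text \<open>On a field, the finite values are closed under negation, so that they already form a group.\<close>

lemma krull_finite_values_group:
  fixes \<nu>\<^sub>0 :: "'k::field \<Rightarrow> 'g::linordered_ab_group_add top"
  assumes K: "krull_valuation \<nu>\<^sub>0" and "\<gamma> \<in> value_group \<nu>\<^sub>0"
  shows "\<exists>c. \<nu>\<^sub>0 c = fin \<gamma>"
proof -
  have v: "valuation \<nu>\<^sub>0" using K by (simp add: krull_valuation_def)
  have grp: "group (additive_group :: 'g monoid)"
    by (rule groupI) (auto simp: additive_group_def algebra_simps intro: exI[of _ "- x" for x])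
  have inv: "inv\<^bsub>additive_group\<^esub> h = - h" for h :: 'g
    by (rule group.inv_equality[OF grp]) (auto simp: additive_group_def)
  show ?thesis
    using assms(2) unfolding value_group_def
  proof (induction rule: generate.induct)
    case one
    show ?case using v by (auto simp: additive_group_def valuation_def zero_top_def)
  next
    case (inv h)
    then obtain a where a: "\<nu>\<^sub>0 a = fin h" by auto
    then have "a \<noteq> 0" using valuation_zero[OF v] by auto
    then have "\<nu>\<^sub>0 a + \<nu>\<^sub>0 (inverse a) = fin 0"
      using v by (simp add: valuation_def zero_top_def flip: valuation_mult[OF v])
    then have "\<nu>\<^sub>0 (inverse a) = fin (- h)"
      using a by (cases "\<nu>\<^sub>0 (inverse a)") (auto simp: eq_neg_iff_add_eq_0 add.commute)
    then show ?case by (auto simp: \<open>inv\<^bsub>additive_group\<^esub> h = - h\<close>)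
  next
    case (eng h1 h2)
    then obtain a b where "\<nu>\<^sub>0 a = fin h1" "\<nu>\<^sub>0 b = fin h2" by blast
    then have "\<nu>\<^sub>0 (a * b) = fin (h1 + h2)" by (simp add: valuation_mult[OF v])
    then show ?case by (auto simp: additive_group_def)
  qed auto
qed

lemma power_value_in_base:
  fixes \<nu>\<^sub>0 :: "'k::field \<Rightarrow> 'g::linordered_ab_group_add top" and \<nu> :: "'k poly \<Rightarrow> 'g top"
  assumes K0: "krull_valuation \<nu>\<^sub>0" and K: "krull_valuation \<nu>"
    and tors: "torsion_group (additive_group\<lparr>carrier := value_group \<nu>\<rparr> Mod value_group \<nu>\<^sub>0)"
    and "f \<noteq> 0"
  obtains m c where "0 < m" and "c \<noteq> 0" and "\<nu> (f ^ m) = \<nu>\<^sub>0 c"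
proof -
  have v: "valuation \<nu>" "valuation \<nu>\<^sub>0" using K K0 by (simp_all add: krull_valuation_def)
  define A where "A = (additive_group\<lparr>carrier := value_group \<nu>\<rparr> :: 'g monoid)"
  define N where "N = value_group \<nu>\<^sub>0"
  obtain \<gamma> where \<gamma>: "\<nu> f = fin \<gamma>" using K \<open>f \<noteq> 0\<close> by (rule krull_valuation_finite)
  define C where "C = N #>\<^bsub>A\<^esub> \<gamma>"
  have zero: "0 \<in> N"
    using generate.one[of additive_group] by (simp add: N_def value_group_def additive_group_def)
  have add: "x \<otimes>\<^bsub>A\<^esub> y = x + y" for x y by (simp add: A_def additive_group_def)
  have "\<gamma> \<in> carrier A"
    using \<gamma> by (auto simp: A_def value_group_def image_iff eq_commute[of "fin \<gamma>"] intro!: generate.incl)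
  then have C: "C \<in> carrier (A Mod N)"
    by (auto simp: C_def FactGroup_def RCOSETS_def)
  have "\<one>\<^bsub>A Mod N\<^esub> = N" by (simp add: FactGroup_def)
  with C obtain m :: nat where m: "0 < m" "C [^]\<^bsub>A Mod N\<^esub> m = N"
    using tors unfolding torsion_group_def A_def[symmetric] N_def[symmetric]
    by auto
  have "\<gamma> \<in> C"
    using zero by (force simp: C_def r_coset_def add)
  \<comment> \<open>Powers in the quotient are products of cosets as sets, so \<open>n\<close>-fold sums of \<open>\<gamma>\<close> can be followed
    inside them without choosing representatives.\<close>
  have "\<exists>\<delta>\<in>C [^]\<^bsub>A Mod N\<^esub> n. \<nu> (f ^ n) = fin \<delta>" for n :: nat
  proof (induction n)
    case 0
    show ?case using zero v by (auto simp: nat_pow_def FactGroup_def valuation_def zero_top_def)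
  next
    case (Suc n)
    then obtain \<delta> where \<delta>: "\<delta> \<in> C [^]\<^bsub>A Mod N\<^esub> n" "\<nu> (f ^ n) = fin \<delta>" by blast
    have "C [^]\<^bsub>A Mod N\<^esub> Suc n = C [^]\<^bsub>A Mod N\<^esub> n <#>\<^bsub>A\<^esub> C"
      by (simp add: nat_pow_def FactGroup_def)
    then have "\<delta> + \<gamma> \<in> C [^]\<^bsub>A Mod N\<^esub> Suc n"
      using \<delta>(1) \<open>\<gamma> \<in> C\<close> by (auto simp: set_mult_def add)
    moreover have "\<nu> (f ^ Suc n) = fin (\<delta> + \<gamma>)"
      using \<delta>(2) \<gamma> by (simp add: valuation_mult[OF v(1)] add.commute)
    ultimately show ?case by blast
  qed
  then obtain \<delta> where \<delta>: "\<delta> \<in> N" "\<nu> (f ^ m) = fin \<delta>"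
    using m(2) by metis
  then obtain c where "\<nu>\<^sub>0 c = fin \<delta>"
    using krull_finite_values_group[OF K0] by (auto simp: N_def)
  moreover from this have "c \<noteq> 0" using valuation_zero[OF v(2)] by auto
  ultimately show ?thesis using that m(1) \<delta>(2) by metis
qed

section \<open>Residue transcendence\<close>

lemma valuation_ring_nat_pow:
  fixes a :: "'a::field" and n :: nat
  shows "a [^]\<^bsub>valuation_ring \<nu>\<^esub> n = a ^ n"
  by (induction n) (simp_all add: nat_pow_def mult.commute)

lemma pcompose_monom_eq:
  fixes t :: "'a::comm_ring_1 poly"
  shows "pcompose (Polynomial.monom a n) t = [:a:] * t ^ n"
proof (induction n)
  case (Suc n)
  then show ?case by (simp add: monom_Suc pcompose_pCons ac_simps del: mult_pCons_left)
qed (simp add: monom_0)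

text \<open>The hypothesis \<open>gauss\<close> says that a polynomial expression in \<open>t\<close> has positive value only if all its
  coefficients do.  A polynomial over the residue field of the base that annihilates the class of
  \<open>t\<close> lifts, coefficient by coefficient, to an expression of positive value; its leading coefficient
  would then vanish in the residue field.\<close>

lemma residue_transcendental_if_gauss:
  fixes \<nu>\<^sub>0 :: "'k::field \<Rightarrow> 'g::linordered_ab_group_add top" and \<mu> :: "'k poly \<Rightarrow> 'g top"
  assumes K0: "krull_valuation \<nu>\<^sub>0" and K: "krull_valuation \<mu>"
    and ext: "\<And>a. \<mu> [:a:] = \<nu>\<^sub>0 a" and t: "\<mu> t = 0"
    and gauss: "\<And>b i. \<mu> (pcompose b t) \<le> \<nu>\<^sub>0 (Polynomial.coeff b i)"
  shows "residue_transcendental \<nu>\<^sub>0 \<mu>"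
proof -
  define \<rho> where "\<rho> = fract_extension \<mu>"
  have K\<rho>: "krull_valuation \<rho>" and \<rho>: "\<rho> (to_fract f) = \<mu> f" for f
    using fract_extension[OF K] by (simp_all add: \<rho>_def)
  define V where "V = valuation_ring \<rho>"
  define I where "I = valuation_ideal \<rho>"
  define L where "L = residue_field \<rho>"
  define k where "k = residue_embedding \<rho> ` carrier (residue_field \<nu>\<^sub>0)"
  have L: "L = V Quot I" by (simp add: L_def V_def I_def residue_field_def)
  interpret V: cring V
    using valuation_ring_cring[OF K\<rho>] by (simp add: V_def)
  interpret I: maximalideal I V
    using valuation_ideal_maximal[OF K\<rho>] by (simp add: V_def I_def)
  interpret F: Ring.field L
    using residue_field_field[OF K\<rho>] by (simp add: L_def)
  interpret F0: Ring.field "residue_field \<nu>\<^sub>0"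
    using residue_field_field[OF K0] .
  define \<phi> where "\<phi> f = I +>\<^bsub>V\<^esub> to_fract f" for f
  interpret h: ring_hom_ring V L "\<lambda>x. I +>\<^bsub>V\<^esub> x"
    using I.rcos_ring_hom_ring by (simp add: L)
  have carr: "to_fract f \<in> carrier V \<longleftrightarrow> 0 \<le> \<mu> f" for f
    by (simp add: V_def \<rho>)
  have \<phi>_zero: "\<phi> f = \<zero>\<^bsub>L\<^esub> \<longleftrightarrow> 0 < \<mu> f" if "0 \<le> \<mu> f" for f
  proof -
    have "\<phi> f = I \<longleftrightarrow> to_fract f \<in> I"
      using I.a_rcos_self[of "to_fract f"] I.a_rcos_const[of "to_fract f"] that
      by (auto simp: \<phi>_def carr)
    then show ?thesis by (simp add: L FactRing_def I_def valuation_ideal_def \<rho>)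
  qed
  have v: "valuation \<mu>" using K by (simp add: krull_valuation_def)
  interpret e: ring_hom_ring "residue_field \<nu>\<^sub>0" L "residue_embedding \<rho>"
    using residue_embedding_hom[OF K0 K\<rho>] \<rho> ext F0.ring_axioms F.ring_axioms
    by (simp add: L_def ring_hom_ringI2)
  have k: "subring k L"
    unfolding k_def by (rule e.img_is_subring[OF F0.carrier_is_subring])
  have lift: "\<exists>a. 0 \<le> \<nu>\<^sub>0 a \<and> x = \<phi> [:a:]" if x: "x \<in> k" for x
  proof -
    obtain a where "0 \<le> \<nu>\<^sub>0 a" "x = residue_embedding \<rho> (valuation_ideal \<nu>\<^sub>0 +>\<^bsub>valuation_ring \<nu>\<^sub>0\<^esub> a)"
      using x by (auto simp: k_def residue_field_def FactRing_def A_RCOSETS_def')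
    then show ?thesis
      using residue_embedding_coset[OF K0 K\<rho>] \<rho> ext by (auto simp: \<phi>_def I_def V_def)
  qed
  define x where "x = \<phi> t"
  have tV: "to_fract t \<in> carrier V" using t by (simp add: carr)
  have x: "x \<in> carrier L"
    using h.hom_closed[OF tV] by (simp add: x_def \<phi>_def)
  have t_pow: "\<mu> (t ^ n) = 0" for n
    using t v by (induction n) (simp_all add: valuation_def)
  have x_pow: "x [^]\<^bsub>L\<^esub> n = \<phi> (t ^ n)" for n :: nat
  proof -
    have "to_fract t [^]\<^bsub>V\<^esub> n = to_fract (t ^ n)"
      unfolding V_def valuation_ring_nat_pow by (induction n) simp_all
    then show ?thesis
      using h.hom_nat_pow[OF tV, of n] by (simp add: x_def \<phi>_def)
  qed
  have \<phi>_add: "\<phi> (f + g) = \<phi> f \<oplus>\<^bsub>L\<^esub> \<phi> g" and \<phi>_mult: "\<phi> (f * g) = \<phi> f \<otimes>\<^bsub>L\<^esub> \<phi> g"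
    if "0 \<le> \<mu> f" "0 \<le> \<mu> g" for f g
    using h.hom_add[of "to_fract f" "to_fract g"] h.hom_mult[of "to_fract f" "to_fract g"] that
    unfolding carr by (simp_all add: \<phi>_def V_def)
  \<comment> \<open>Lifting: lists hold the leading coefficient first, at the exponent \<open>length p - 1\<close>.  The vanishing
    of the coefficients from \<open>length p\<close> on keeps the new leading coefficient from mixing with older
    ones.\<close>
  have ev: "\<exists>b. 0 \<le> \<mu> (pcompose b t) \<and> F.eval p x = \<phi> (pcompose b t) \<and>
      (\<forall>i\<ge>length p. Polynomial.coeff b i = 0) \<and>
      (p \<noteq> [] \<longrightarrow> 0 \<le> \<nu>\<^sub>0 (Polynomial.coeff b (length p - 1)) \<and>
        hd p = \<phi> [:Polynomial.coeff b (length p - 1):])"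
    if "set p \<subseteq> k" for p
    using that
  proof (induction p)
    case Nil
    have "0 < \<mu> 0" using valuation_zero[OF v] by (simp add: zero_top_def)
    then show ?case
      using \<phi>_zero[of 0] by (intro exI[of _ 0]) simp
  next
    case (Cons y p)
    then obtain b where b: "0 \<le> \<mu> (pcompose b t)" "F.eval p x = \<phi> (pcompose b t)"
        "\<forall>i\<ge>length p. Polynomial.coeff b i = 0"
      by auto
    obtain a where a: "0 \<le> \<nu>\<^sub>0 a" "y = \<phi> [:a:]"
      using lift[of y] Cons.prems by auto
    define n where "n = length p"
    define b' where "b' = Polynomial.monom a n + b"
    have comp: "pcompose b' t = [:a:] * t ^ n + pcompose b t"
      by (simp add: b'_def pcompose_add pcompose_monom_eq)
    have nonneg: "0 \<le> \<mu> ([:a:] * t ^ n)"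
      unfolding valuation_mult[OF v] ext t_pow using a(1) by simp
    have "F.eval (y # p) x = y \<otimes>\<^bsub>L\<^esub> x [^]\<^bsub>L\<^esub> n \<oplus>\<^bsub>L\<^esub> \<phi> (pcompose b t)"
      using b(2) by (simp add: n_def)
    also have "\<dots> = \<phi> (pcompose b' t)"
      unfolding comp \<phi>_add[OF nonneg b(1)] x_pow a(2)
      using a(1) by (subst \<phi>_mult) (simp_all add: ext t_pow)
    finally have "F.eval (y # p) x = \<phi> (pcompose b' t)" .
    moreover have "0 \<le> \<mu> (pcompose b' t)"
      using valuation_add[OF v, of "[:a:] * t ^ n" "pcompose b t"] nonneg b(1)
      unfolding comp by (meson min.boundedI order_trans)
    moreover have "Polynomial.coeff b' n = a" "\<forall>i\<ge>Suc n. Polynomial.coeff b' i = 0"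
      using b(3) by (simp_all add: b'_def n_def)
    ultimately show ?case
      using a by (intro exI[of _ b']) (simp add: n_def)
  qed
  have ker: "p = []" if p: "p \<in> carrier (k [X]\<^bsub>L\<^esub>)" "F.eval p x = \<zero>\<^bsub>L\<^esub>" for p
  proof (rule ccontr)
    assume "p \<noteq> []"
    then have "set p \<subseteq> k" "hd p \<noteq> \<zero>\<^bsub>L\<^esub>"
      using p(1) by (auto simp: polynomial_def simp flip: univ_poly_carrier)
    then obtain b where b: "0 \<le> \<mu> (pcompose b t)" "F.eval p x = \<phi> (pcompose b t)"
        "0 \<le> \<nu>\<^sub>0 (Polynomial.coeff b (length p - 1))" "hd p = \<phi> [:Polynomial.coeff b (length p - 1):]"
      using ev[of p] \<open>p \<noteq> []\<close> by blast
    have "0 < \<mu> (pcompose b t)"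
      using \<phi>_zero[OF b(1)] b(2) p(2) by simp
    also have "\<dots> \<le> \<nu>\<^sub>0 (Polynomial.coeff b (length p - 1))"
      by (rule gauss)
    finally have "hd p = \<zero>\<^bsub>L\<^esub>"
      using b(4) \<phi>_zero[of "[:Polynomial.coeff b (length p - 1):]"] ext by simp
    then show False using \<open>hd p \<noteq> \<zero>\<^bsub>L\<^esub>\<close> by simp
  qed
  have "a_kernel (k [X]\<^bsub>L\<^esub>) L (\<lambda>p. F.eval p x) = {[]}"
    using ker by (auto simp: a_kernel_def' univ_poly_def polynomial_def)
  then have "(F.transcendental over k) x"
    by (rule F.trivial_ker_imp_transcendental[OF k x])
  then show ?thesis
    using K x by (auto simp: residue_transcendental_def transcendental_extension_def L_def k_def \<rho>_def)
qed

lemma truncation_krull: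
  assumes K: "krull_valuation \<nu>" and key: "key_polynomial \<nu> Q"
  shows "krull_valuation (truncation \<nu> Q)"
proof -
  have v: "valuation \<nu>" using K by (simp add: krull_valuation_def)
  have "f = 0" if "truncation \<nu> Q f = infty" for f
    using that truncation_le[OF v key_deg[OF v key], of f] K
    by (auto simp: krull_valuation_def dest: less_eq_top_is_Top)
  then show ?thesis
    using truncation_valuation[OF v key] by (simp add: krull_valuation_def)
qed

text \<open>The witness is \<open>Q ^ m\<close> divided by a constant of the same value.\<close>

lemma truncation_residue_transcendental:
  fixes \<nu>\<^sub>0 :: "'k::field \<Rightarrow> 'g::linordered_ab_group_add top" and \<nu> :: "'k poly \<Rightarrow> 'g top"
  assumes K0: "krull_valuation \<nu>\<^sub>0" and K: "krull_valuation \<nu>"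
    and ext: "\<And>a. \<nu> [:a:] = \<nu>\<^sub>0 a" and key: "key_polynomial \<nu> Q"
    and tors: "torsion_group (additive_group\<lparr>carrier := value_group \<nu>\<rparr> Mod value_group \<nu>\<^sub>0)"
  shows "residue_transcendental \<nu>\<^sub>0 (truncation \<nu> Q)"
proof -
  let ?w = "truncation \<nu> Q"
  have v: "valuation \<nu>" "valuation \<nu>\<^sub>0" using K K0 by (simp_all add: krull_valuation_def)
  note deg = key_deg[OF v(1) key]
  have w: "valuation ?w" using v(1) key by (rule truncation_valuation)
  have wc: "?w [:a:] = \<nu>\<^sub>0 a" for a
    using truncation_const[OF v(1) key] ext by simp
  have "Q \<noteq> 0" using deg by auto
  with K0 K tors obtain m c where m: "0 < m" and c: "c \<noteq> 0" "\<nu> (Q ^ m) = \<nu>\<^sub>0 c"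
    by (rule power_value_in_base)
  \<comment> \<open>Dividing by \<open>c\<close> inside the polynomial ring keeps all representatives polynomial.\<close>
  define t where "t = [:inverse c:] * Q ^ m"
  have "?w (Q ^ m) = \<nu>\<^sub>0 c"
    using truncation_times_key_power[OF v(1) deg, of m 1] truncation_const[OF v(1) key, of 1] v c(2)
    by (simp add: valuation_def one_pCons)
  then have wt: "?w t = 0"
    using c(1) v(2) unfolding t_def valuation_mult[OF w] wc
    by (simp add: valuation_def flip: valuation_mult[OF v(2)])
  show ?thesis
  proof (rule residue_transcendental_if_gauss[OF K0 truncation_krull[OF K key] wc wt])
    fix b :: "'k poly" and i
    show "?w (pcompose b t) \<le> \<nu>\<^sub>0 (Polynomial.coeff b i)"
    proof (induction b arbitrary: i)
      case 0
      then show ?case using v(2) by (simp add: valuation_zero)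
    next
      case (pCons a b)
      obtain n where n: "m = Suc n" using m by (cases m) auto
      define g where "g = [:inverse c:] * Q ^ n * pcompose b t"
      have g: "t * pcompose b t = Q * g"
        by (simp add: t_def g_def n ac_simps)
      \<comment> \<open>\<open>t\<close> is divisible by \<open>Q\<close>, so \<open>a\<close> is the lowest digit of \<open>[:a:] + t * pcompose b t\<close>.\<close>
      have "\<nu> Q + ?w g = ?w (Q * g)"
        using truncation_times_key[OF v(1) deg, of g] by simp
      also have "\<dots> = ?w (pcompose b t)"
        unfolding g[symmetric] valuation_mult[OF w] wt by simp
      finally have "?w (pcompose (pCons a b) t) = min (\<nu>\<^sub>0 a) (?w (pcompose b t))"
        using truncation_step[OF v(1) deg, of "[:a:]" g] deg ext by (simp add: pcompose_pCons g)
      then show ?case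
        using pCons(2) by (cases i) (auto simp: min_le_iff_disj)
    qed
  qed
qed

section \<open>The chain of truncations\<close>

theorem proposition6p9:
  fixes \<nu>\<^sub>0 :: "'k::field \<Rightarrow> 'g::linordered_ab_group_add top"
    and \<nu> :: "'k poly \<Rightarrow> 'g top"
  assumes "krull_valuation \<nu>\<^sub>0"
    and "divisible_group (additive_group :: 'g monoid)"
    and "Some \<nu> \<in> valuation_poset \<nu>\<^sub>0"
    and "valuation_algebraic \<nu>\<^sub>0 \<nu>"
  shows "\<exists>\<v> :: ('k poly \<Rightarrow> 'g top) set.
      Some ` \<v> \<subseteq> valuation_poset \<nu>\<^sub>0 \<and>
      Complete_Partial_Order.chain (\<le>) \<v> \<and>
      \<not> (\<exists>\<mu>\<in>\<v>. \<forall>\<mu>'\<in>\<v>. \<mu>' \<le> \<mu>) \<and>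
      (\<forall>f. stable_in \<v> f) \<and>
      \<nu> = stable_sup \<v> \<and>
      (\<forall>\<mu>\<in>\<v>. residue_transcendental \<nu>\<^sub>0 \<mu>)"
proof -
  have v: "valuation \<nu>" and ext: "\<And>a. \<nu> [:a:] = \<nu>\<^sub>0 a"
    using assms(3) by (auto simp: valuation_poset_def)
  have K: "krull_valuation \<nu>" and not_res: "\<not> residue_transcendental \<nu>\<^sub>0 \<nu>"
    and tors: "torsion_group (additive_group\<lparr>carrier := value_group \<nu>\<rparr> Mod value_group \<nu>\<^sub>0)"
    using assms(4)
    by (auto simp: valuation_algebraic_def valuation_transcendental_def value_transcendental_def)
  define \<v> where "\<v> = truncation \<nu> ` {Q. key_polynomial \<nu> Q}"
  have below: "\<mu> \<le> \<nu>" if "\<mu> \<in> \<v>" for \<mu>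
    using that truncation_le[OF v key_deg[OF v]] by (auto simp: \<v>_def le_fun_def)
  have res: "residue_transcendental \<nu>\<^sub>0 \<mu>" if "\<mu> \<in> \<v>" for \<mu>
    using that truncation_residue_transcendental[OF assms(1) K ext _ tors] by (auto simp: \<v>_def)
  have exact: "\<exists>\<mu>\<in>\<v>. \<mu> f = \<nu> f" for f
    using truncation_exact[OF K, of f] by (auto simp: \<v>_def)
  have chain: "Complete_Partial_Order.chain (\<le>) \<v>"
    using truncation_chain[OF v] by (auto simp: \<v>_def chain_def)
  have stable: "\<exists>\<mu>. stable_from \<v> \<mu> f \<and> \<mu> f = \<nu> f" for f
  proof -
    obtain \<mu> where \<mu>: "\<mu> \<in> \<v>" "\<mu> f = \<nu> f" using exact by blast
    have "\<mu>' f = \<mu> f" if "\<mu>' \<in> \<v>" "\<mu> \<le> \<mu>'" for \<mu>'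
      using below[OF that(1)] that(2) \<mu>(2) by (metis antisym le_funD)
    then have "stable_from \<v> \<mu> f" using \<mu>(1) by (simp add: stable_from_def)
    then show ?thesis using \<mu>(2) by blast
  qed
  have no_max: "\<not> (\<exists>\<mu>\<in>\<v>. \<forall>\<mu>'\<in>\<v>. \<mu>' \<le> \<mu>)"
  proof
    assume "\<exists>\<mu>\<in>\<v>. \<forall>\<mu>'\<in>\<v>. \<mu>' \<le> \<mu>"
    then obtain \<mu> where \<mu>: "\<mu> \<in> \<v>" "\<forall>\<mu>'\<in>\<v>. \<mu>' \<le> \<mu>" by blast
    have "\<nu> f \<le> \<mu> f" for f
      using exact[of f] \<mu>(2) by (metis le_funD)
    then have "\<mu> = \<nu>"
      using below[OF \<mu>(1)] by (metis antisym le_funI)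
    then show False using res[OF \<mu>(1)] not_res by simp
  qed
  have "\<nu> = stable_sup \<v>"
  proof
    fix f
    show "\<nu> f = stable_sup \<v> f"
      using stable[of f] stable_sup_eq[OF chain] by metis
  qed
  moreover have "Some ` \<v> \<subseteq> valuation_poset \<nu>\<^sub>0"
    using truncation_valuation[OF v] truncation_const[OF v] ext
    by (auto simp: \<v>_def valuation_poset_def)
  moreover have "\<forall>f. stable_in \<v> f"
    using stable by (auto simp: stable_in_def)
  ultimately show ?thesis using chain no_max res by blast
qed

end
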